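(* Let $\lambda>1$ and $0<\alpha<1/2$, and let $0<\delta<1-2\alpha$. Then there exist a natural number $n_0$, a sequence of times $0=t_{n_0}<t_{n_0+1}<t_{n_0+2}<\dots$ increasing to a finite limit $T_*$, and continuous, piecewise smooth functions $X_n:[0,T_* )\to\mathbb{R}$ for $n\ge n_0$, such that $X_{n_0+k}(t)=0$ whenever $k\ge1$ and $0\le t\le t_{n_0+k-1}$, and such that $$\partial_tX_n=-\lambda^{2n\alpha}X_n+1_{(t_{n-1},t_n)}(t)\,\lambda^{n-1}X_{n-1}^2-1_{(t_n,t_{n+1})}(t)\,\lambda^nX_nX_{n+1}$$ for all $t\in[0,T_* )$ other than the times $t_{n_0},t_{n_0+1},\dots$, and all $n\ge n_0$, with the convention that $t_{n_0-1}=0$ and $X_{n_0-1}=0$. Furthermore, $$X_{n_0+k}(t_{n_0+k})=\lambda^{-\delta k}$$ for every $k\ge0$. In particular, for any $\delta'>\delta$, $$\limsup_{t\to T_*}\ \sup_{n}\ \lambda^{\delta'n}|X_n(t)|=+\infty.$$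
   Context: $1_{(a,b)}$ denotes the indicator function of the interval $(a,b)$. *)

theory Defs
  imports "HOL-Analysis.Analysis"
begin

(* C-infinity on S, with one-sided derivatives at boundary points of S:
   D k is the k-th derivative of f relative to S. *)
definition smooth_within :: "real set \<Rightarrow> (real \<Rightarrow> real) \<Rightarrow> bool" where
  "smooth_within S f \<longleftrightarrow>
     (\<exists>D :: nat \<Rightarrow> real \<Rightarrow> real. (\<forall>x\<in>S. D 0 x = f x) \<and>
        (\<forall>k. \<forall>x\<in>S. (D k has_real_derivative D (Suc k) x) (at x within S)))"

(* For continuous f on an interval I: finitely many breakpoints P, and f is smooth up to and
   including the endpoints on every compact subinterval of I with no breakpoint in its interior. *)
definition piecewise_smooth_on :: "real set \<Rightarrow> (real \<Rightarrow> real) \<Rightarrow> bool" where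
  "piecewise_smooth_on I f \<longleftrightarrow>
     (\<exists>P. finite P \<and>
        (\<forall>a b. a < b \<and> {a..b} \<subseteq> I \<and> {a<..<b} \<inter> P = {} \<longrightarrow> smooth_within {a..b} f))"

(* The (n-1)-st term of a sequence indexed by n \<ge> n0, with the convention that the term of
   index n0 - 1 (which is not a natural number if n0 = 0) is zero. *)
definition prev_term :: "nat \<Rightarrow> (nat \<Rightarrow> real) \<Rightarrow> nat \<Rightarrow> real" where
  "prev_term n0 u n = (if n = n0 then 0 else u (n - 1))"

end

(* Write n = n0 + k. On [t_n, t_(n+1)] the modes X = X_n and Y = X_(n+1) solve
   X' = -A_k X - B_k X Y, Y' = -A_(k+1) Y + B_k X^2 from X = c_k, Y = 0, where
   A_k = lam^(2 n alpha), B_k = lam^n, c_k = lam^(-delta k). Rescaling amplitude by c_k and time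
   by c_k B_k turns this into x' = -a x - x y, y' = -b y + x^2, x(0) = 1, y(0) = 0, with
   a <= b = A_(k+1) / (c_k B_k) arbitrarily small uniformly in k once n0 is large, because
   delta < 1 - 2 alpha. Since (x^2 + y^2) exp (2 b s) is nondecreasing, y' stays bounded below as
   long as y < q = lam^(-delta), so y reaches q by a time depending only on q. Hence
   t_(n+1) - t_n = O(1 / (c_k B_k)) is summable, and gluing the pieces (after t_(n+1) the mode X_n
   just decays exponentially) gives the cascade. *)
theory Submission
  imports Defs
begin

subsection \<open>Smoothness of solutions of polynomial systems\<close>

inductive_set gen_alg :: "(real \<Rightarrow> real) set \<Rightarrow> (real \<Rightarrow> real) set" for G where
  const: "(\<lambda>_. c) \<in> gen_alg G"
| gen: "g \<in> G \<Longrightarrow> g \<in> gen_alg G"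
| add: "f \<in> gen_alg G \<Longrightarrow> g \<in> gen_alg G \<Longrightarrow> (\<lambda>s. f s + g s) \<in> gen_alg G"
| mult: "f \<in> gen_alg G \<Longrightarrow> g \<in> gen_alg G \<Longrightarrow> (\<lambda>s. f s * g s) \<in> gen_alg G"

lemma smooth_within_derivation_closed:
  assumes f: "f \<in> C"
    and C: "\<And>g. g \<in> C \<Longrightarrow> \<exists>g'\<in>C. \<forall>s\<in>S. (g has_real_derivative g' s) (at s within S)"
  shows "smooth_within S f"
proof -
  obtain D where D: "\<And>g. g \<in> C \<Longrightarrow> D g \<in> C"
      "\<And>g s. g \<in> C \<Longrightarrow> s \<in> S \<Longrightarrow> (g has_real_derivative D g s) (at s within S)"
    using C by metis
  have "(D ^^ k) f \<in> C" for k
    by (induction k) (use f D(1) in auto)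
  then show ?thesis
    unfolding smooth_within_def using D(2) by (intro exI[of _ "\<lambda>k. (D ^^ k) f"]) auto
qed

lemma smooth_within_gen_alg:
  assumes f: "f \<in> gen_alg G"
    and G: "\<And>g. g \<in> G \<Longrightarrow> \<exists>g'\<in>gen_alg G. \<forall>s\<in>S. (g has_real_derivative g' s) (at s within S)"
  shows "smooth_within S f"
proof (rule smooth_within_derivation_closed[OF f])
  fix g assume "g \<in> gen_alg G"
  then show "\<exists>g'\<in>gen_alg G. \<forall>s\<in>S. (g has_real_derivative g' s) (at s within S)"
  proof induction
    case (const c)
    then show ?case by (intro bexI[of _ "\<lambda>_. 0"]) (auto intro: gen_alg.const)
  next
    case (gen g)
    then show ?case by (rule G)
  next
    case (add f g)
    then obtain f' g' where "f' \<in> gen_alg G" "g' \<in> gen_alg G"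
      "\<forall>s\<in>S. (f has_real_derivative f' s) (at s within S)"
      "\<forall>s\<in>S. (g has_real_derivative g' s) (at s within S)" by blast
    then show ?case
      by (intro bexI[of _ "\<lambda>s. f' s + g' s"]) (auto intro: gen_alg.add DERIV_add)
  next
    case (mult f g)
    then obtain f' g' where "f' \<in> gen_alg G" "g' \<in> gen_alg G"
      "\<forall>s\<in>S. (f has_real_derivative f' s) (at s within S)"
      "\<forall>s\<in>S. (g has_real_derivative g' s) (at s within S)" by blast
    with mult.hyps show ?case
      by (intro bexI[of _ "\<lambda>s. f' s * g s + g' s * f s"])
        (auto intro: gen_alg.add gen_alg.mult DERIV_mult)
  qed
qed

lemma smooth_within_interaction:
  fixes x y :: "real \<Rightarrow> real"
  assumes x: "\<And>s. s \<in> S \<Longrightarrow> (x has_real_derivative - A * x s - B * x s * y s) (at s within S)"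
    and y: "\<And>s. s \<in> S \<Longrightarrow> (y has_real_derivative - C * y s + D * (x s)\<^sup>2) (at s within S)"
  shows "smooth_within S x" and "smooth_within S y"
proof -
  let ?G = "{x, y}"
  have "x \<in> gen_alg ?G" "y \<in> gen_alg ?G" by (auto intro: gen_alg.gen)
  note alg = this gen_alg.const gen_alg.add gen_alg.mult
  have x': "(\<lambda>s. (- A) * x s + (- B) * x s * y s) \<in> gen_alg ?G"
    and y': "(\<lambda>s. (- C) * y s + D * (x s * x s)) \<in> gen_alg ?G"
    by (intro alg)+
  have "\<exists>g'\<in>gen_alg ?G. \<forall>s\<in>S. (g has_real_derivative g' s) (at s within S)"
    if "g \<in> ?G" for g
    using that
  proof (elim insertE emptyE)
    assume "g = x"
    with x show ?thesis by (intro bexI[OF _ x']) simp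
  next
    assume "g = y"
    with y show ?thesis by (intro bexI[OF _ y']) (simp add: power2_eq_square)
  qed
  then show "smooth_within S x" "smooth_within S y"
    using smooth_within_gen_alg alg(1,2) by blast+
qed

lemma has_real_derivative_affine:
  fixes f :: "real \<Rightarrow> real"
  assumes "(f has_real_derivative D) (at (c * (s - p)) within T)"
    and "(\<lambda>r. c * (r - p)) ` S \<subseteq> T"
  shows "((\<lambda>r. f (c * (r - p))) has_real_derivative D * c) (at s within S)"
proof -
  have "((\<lambda>r. c * (r - p)) has_real_derivative c) (at s within S)"
    by (auto intro!: derivative_eq_intros)
  from DERIV_image_chain[OF has_field_derivative_subset[OF assms] this]
  show ?thesis by (simp add: o_def)
qed

lemma has_real_derivative_transform_on:
  fixes f g :: "real \<Rightarrow> real"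
  assumes "(f has_real_derivative D) (at s within S)" "s \<in> S" "\<And>r. r \<in> S \<Longrightarrow> g r = f r"
  shows "(g has_real_derivative D) (at s within S)"
  using assms unfolding has_field_derivative_def by (metis has_derivative_transform)

subsection \<open>Two interacting modes\<close>

lemma exp_neg_diff_le:
  fixes u v :: real
  assumes "0 \<le> u" "0 \<le> v"
  shows "\<bar>exp (- u) - exp (- v)\<bar> \<le> \<bar>u - v\<bar>"
proof -
  have *: "exp (- u) - exp (- v) \<le> v - u" if "0 \<le> u" "u \<le> v" for u v :: real
  proof -
    have "exp (-u) * (1 + (u - v)) \<le> exp (-u) * exp (u - v)"
      by (intro mult_left_mono exp_ge_add_one_self) auto
    also have "\<dots> = exp (- v)" by (simp flip: exp_add)
    finally have "exp (- u) - exp (- v) \<le> exp (- u) * (v - u)" by (simp add: algebra_simps)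
    also have "\<dots> \<le> 1 * (v - u)" using that by (intro mult_right_mono) auto
    finally show ?thesis by simp
  qed
  show ?thesis
    using *[of u v] *[of v u] assms by (cases "u \<le> v") auto
qed

lemma integral_exp_double:
  fixes t :: real
  assumes "0 \<le> t"
  shows "integral {0..t} (\<lambda>s. d * exp (2 * s)) = d * (exp (2 * t) - 1) / 2"
proof -
  have "((\<lambda>s. d * exp (2 * s)) has_integral (d * exp (2*t) / 2 - d * exp (2 * 0) / 2)) {0..t}"
    by (rule fundamental_theorem_of_calculus[OF assms])
      (auto intro!: derivative_eq_intros simp flip: has_real_derivative_iff_has_vector_derivative)
  then show ?thesis by (simp only: integral_unique) (simp add: algebra_simps diff_divide_distrib)
qed

text \<open>
  Integrating the first equation gives \<open>x = exp (- a t - \<integral> y)\<close>, which leaves a fixed-point problem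
  for \<open>y\<close> alone. It is a contraction in the weighted norm \<open>sup exp (- 2 t) \<bar>y t\<bar>\<close>, so the unknown
  below is \<open>w = exp (- 2 t) y\<close>; truncating \<open>y\<close> at 0 makes \<open>x \<le> 1\<close> automatic, and the fixed point is
  nonnegative anyway.
\<close>
lemma interaction_exists:
  fixes a b S :: real
  assumes a: "0 \<le> a" and b: "0 \<le> b"
  shows "\<exists>x y :: real \<Rightarrow> real. x 0 = 1 \<and> y 0 = 0 \<and> 
    (\<forall>s\<in>{0..S}. (x has_real_derivative - a * x s - x s * y s) (at s within {0..S}) \<and>
                (y has_real_derivative - b * y s + (x s)\<^sup>2) (at s within {0..S}) \<and> 0 \<le> y s)"
proof -
  define P where "P w t = integral {0..t} (\<lambda>s. max 0 (exp (2 * s) * w s))" for w :: "real \<Rightarrow> real" and t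
  define x where "x w t = exp (- (a * t + P w t))" for w :: "real \<Rightarrow> real" and t
  define y where "y w t = exp (- b * t) * integral {0..t} (\<lambda>s. exp (b * s) * (x w s)\<^sup>2)" for w :: "real \<Rightarrow> real" and t
  define F where "F w t = exp (- 2 * max 0 t) * y w (max 0 t)" for w :: "real \<Rightarrow> real" and t
  have cp: "continuous_on {0..M} (\<lambda>s. max 0 (exp (2 * s) * w s))" if "continuous_on UNIV w" for w :: "real \<Rightarrow> real" and M
    by (intro continuous_intros continuous_on_subset[OF that]) auto
  have dP: "(P w has_real_derivative max 0 (exp (2 * t) * w t)) (at t within {0..M})"
    if "continuous_on UNIV w" "t \<in> {0..M}" for w t M
    unfolding P_def by (rule integral_has_real_derivative[OF cp[OF that(1)] that(2)])
  have dx: "(x w has_real_derivative (- a - max 0 (exp (2 * t) * w t)) * x w t) (at t within {0..M})"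
    if "continuous_on UNIV w" "t \<in> {0..M}" for w t M
    unfolding x_def by (rule derivative_eq_intros dP[OF that] refl | simp)+
  have P0: "P w t \<ge> 0" if "continuous_on UNIV w" for w t
    unfolding P_def by (intro integral_nonneg integrable_continuous_real cp that) auto
  have cx: "continuous_on {0..M} (x w)" if "continuous_on UNIV w" for w M
    using dx[OF that] by (rule DERIV_continuous_on)
  have x1: "x w t \<le> 1" "0 < x w t" if "continuous_on UNIV w" "0 \<le> t" for w t
    unfolding x_def using add_nonneg_nonneg[OF mult_nonneg_nonneg[OF a that(2)] P0[OF that(1), of t]] by auto
  have cy: "continuous_on {0..M} (\<lambda>s. exp (b * s) * (x w s)\<^sup>2)" if "continuous_on UNIV w" for w M
    by (intro continuous_intros cx that)
  have dy: "(y w has_real_derivative - b * y w t + (x w t)\<^sup>2) (at t within {0..M})"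
    if "continuous_on UNIV w" "t \<in> {0..M}" for w t M
    unfolding y_def
    by (rule derivative_eq_intros integral_has_real_derivative[OF cy[OF that(1)] that(2)] refl | simp)+
      (simp add: algebra_simps flip: exp_add)
  have y0: "y w t \<ge> 0" if "continuous_on UNIV w" for w t
    unfolding y_def by (intro mult_nonneg_nonneg integral_nonneg integrable_continuous_real cy that) auto
  have yt: "y w t \<le> t" if "continuous_on UNIV w" "0 \<le> t" for w t
  proof -
    have "integral {0..t} (\<lambda>s. exp (b * s) * (x w s)\<^sup>2) \<le> integral {0..t} (\<lambda>s. exp (b * t))"
    proof (intro integral_le integrable_continuous_real cy that continuous_intros)
      fix s assume s: "s \<in> {0..t}"
      have "exp (b * s) * (x w s)\<^sup>2 \<le> exp (b * t) * 1\<^sup>2"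
        using s b x1[OF that(1), of s] by (intro mult_mono power_mono) (auto intro: mult_left_mono)
      then show "exp (b * s) * (x w s)\<^sup>2 \<le> exp (b * t)" by simp
    qed
    then have "y w t \<le> exp (- b * t) * (t * exp (b * t))"
      unfolding y_def using that by (intro mult_left_mono) auto
    also have "\<dots> = t" by (simp flip: exp_add)
    finally show ?thesis .
  qed
  have F_cont: "continuous_on UNIV (F w)" if "continuous_on UNIV w" for w
  proof -
    have c0: "continuous_on {0..M} (y w)" for M
      using dy[OF that] by (rule DERIV_continuous_on)
    have "isCont (F w) t" for t
    proof -
      have "continuous_on {..<\<bar>t\<bar> + 1} (F w)"
        unfolding F_def
        by (intro continuous_intros continuous_on_compose2[OF c0[of "\<bar>t\<bar> + 1"]]) auto
      then show ?thesis
        by (rule continuous_on_interior) (auto simp: interior_open)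
    qed
    then show ?thesis by (simp add: continuous_at_imp_continuous_on)
  qed
  have F_bound: "\<bar>F w t\<bar> \<le> 1" if "continuous_on UNIV w" for w t
  proof -
    have "y w (max 0 t) \<le> exp (2 * max 0 t)"
      using yt[OF that, of "max 0 t"] exp_ge_add_one_self[of "2 * max 0 t"] by linarith
    then have "exp (- 2 * max 0 t) * y w (max 0 t) \<le> exp (- 2 * max 0 t) * exp (2 * max 0 t)"
      by (intro mult_left_mono) auto
    then show ?thesis
      using y0[OF that, of "max 0 t"] by (simp add: F_def abs_mult flip: exp_add)
  qed
  have F_bcont: "F w \<in> bcontfun" if "continuous_on UNIV w" for w
    using F_cont[OF that] F_bound[OF that]
    by (intro bcontfun_normI[where b = 1]) auto
  define \<Phi> where "\<Phi> W = Bcontfun (F (apply_bcontfun W))" for W :: "real \<Rightarrow>\<^sub>C real"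
  have cW: "continuous_on UNIV (apply_bcontfun W)" for W :: "real \<Rightarrow>\<^sub>C real"
    by (simp add: continuous_on_apply_bcontfun)
  have \<Phi>: "apply_bcontfun (\<Phi> W) t = F (apply_bcontfun W) t" for W t
    unfolding \<Phi>_def by (simp add: Bcontfun_inverse F_bcont cW)
  have max0: "\<bar>max 0 u - max 0 v\<bar> \<le> \<bar>u - v\<bar>" for u v :: real by arith
  have diffP: "\<bar>P (apply_bcontfun V) t - P (apply_bcontfun W) t\<bar> \<le> dist V W * exp (2 * t) / 2"
    if "0 \<le> t" for V W t
  proof -
    have "\<bar>P (apply_bcontfun V) t - P (apply_bcontfun W) t\<bar> =
      norm (integral {0..t} (\<lambda>s. max 0 (exp (2 * s) * V s) - max 0 (exp (2 * s) * W s)))"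
      unfolding P_def by (simp add: integral_diff integrable_continuous_real cp cW)
    also have "\<dots> \<le> integral {0..t} (\<lambda>s. dist V W * exp (2 * s))"
    proof (intro integral_norm_bound_integral integrable_continuous_real continuous_intros cp cW)
      fix s
      have "\<bar>max 0 (exp (2 * s) * V s) - max 0 (exp (2 * s) * W s)\<bar> \<le> \<bar>exp (2 * s) * V s - exp (2 * s) * W s\<bar>"
        using max0[of "exp (2 * s) * V s" "exp (2 * s) * W s"] .
      also have "\<dots> = exp (2 * s) * dist (V s) (W s)"
        by (simp add: dist_real_def abs_mult flip: right_diff_distrib)
      also have "\<dots> \<le> exp (2 * s) * dist V W" by (intro mult_left_mono dist_bounded) auto
      finally show "norm (max 0 (exp (2 * s) * V s) - max 0 (exp (2 * s) * W s)) \<le> dist V W * exp (2 * s)"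
        by (simp add: mult.commute)
    qed (auto intro: continuous_on_subset[OF cW])
    also have "\<dots> \<le> dist V W * exp (2 * t) / 2"
      unfolding integral_exp_double[OF that] by (simp add: mult_left_mono)
    finally show ?thesis .
  qed
  have diffx: "\<bar>(x (apply_bcontfun V) t)\<^sup>2 - (x (apply_bcontfun W) t)\<^sup>2\<bar> \<le> dist V W * exp (2 * t)"
    if "0 \<le> t" for V W t
  proof -
    have sq: "(x w t)\<^sup>2 = exp (- (2 * (a * t + P w t)))" for w
      unfolding x_def power2_eq_square by (simp flip: exp_add)
    have "\<bar>(x (apply_bcontfun V) t)\<^sup>2 - (x (apply_bcontfun W) t)\<^sup>2\<bar> \<le>
       \<bar>2 * (a * t + P (apply_bcontfun V) t) - 2 * (a * t + P (apply_bcontfun W) t)\<bar>"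
      unfolding sq using a that P0[OF cW, of V t] P0[OF cW, of W t] 
      by (intro exp_neg_diff_le) auto
    also have "\<dots> \<le> dist V W * exp (2 * t)" using diffP[OF that, of V W] by argo
    finally show ?thesis .
  qed
  have diffy: "\<bar>y (apply_bcontfun V) t - y (apply_bcontfun W) t\<bar> \<le> dist V W * exp (2 * t) / 2"
    if "0 \<le> t" for V W t
  proof -
    have "y (apply_bcontfun V) t - y (apply_bcontfun W) t = exp (- b * t) *
      integral {0..t} (\<lambda>s. exp (b * s) * (x (apply_bcontfun V) s)\<^sup>2 - exp (b * s) * (x (apply_bcontfun W) s)\<^sup>2)"
      unfolding y_def
      by (simp add: integral_diff integrable_continuous_real cy cW right_diff_distrib)
    then have "\<bar>y (apply_bcontfun V) t - y (apply_bcontfun W) t\<bar> = exp (- b * t) *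
      norm (integral {0..t} (\<lambda>s. exp (b * s) * (x (apply_bcontfun V) s)\<^sup>2 - exp (b * s) * (x (apply_bcontfun W) s)\<^sup>2))"
      by (simp add: abs_mult)
    also have "\<dots> \<le> exp (- b * t) * integral {0..t} (\<lambda>s. (exp (b * t) * dist V W) * exp (2 * s))"
    proof (intro mult_left_mono integral_norm_bound_integral integrable_continuous_real continuous_intros cy cW)
      fix s assume s: "s \<in> {0..t}"
      have "norm (exp (b * s) * (x (apply_bcontfun V) s)\<^sup>2 - exp (b * s) * (x (apply_bcontfun W) s)\<^sup>2)
        = exp (b * s) * \<bar>(x (apply_bcontfun V) s)\<^sup>2 - (x (apply_bcontfun W) s)\<^sup>2\<bar>"
        by (simp add: abs_mult flip: right_diff_distrib)
      also have "\<dots> \<le> exp (b * t) * (dist V W * exp (2 * s))"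
        using s b diffx[of s V W] by (intro mult_mono) (auto intro: mult_left_mono)
      finally show "norm (exp (b * s) * (x (apply_bcontfun V) s)\<^sup>2 - exp (b * s) * (x (apply_bcontfun W) s)\<^sup>2)
        \<le> exp (b * t) * dist V W * exp (2 * s)" by simp
    qed (auto intro: cx cW)
    also have "\<dots> = dist V W * (exp (2 * t) - 1) / 2"
      unfolding integral_exp_double[OF that] by (simp add: exp_minus)
    also have "\<dots> \<le> dist V W * exp (2 * t) / 2"
      by (simp add: mult_left_mono)
    finally show ?thesis .
  qed
  have contr: "dist (\<Phi> V) (\<Phi> W) \<le> (1/2) * dist V W" for V W
  proof (rule dist_bound)
    fix t :: real
    let ?t = "max 0 t"
    have "dist (\<Phi> V t) (\<Phi> W t) = exp (- 2 * ?t) * \<bar>y (apply_bcontfun V) ?t - y (apply_bcontfun W) ?t\<bar>"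
      unfolding \<Phi> F_def dist_real_def by (simp add: abs_mult flip: right_diff_distrib)
    also have "\<dots> \<le> exp (- 2 * ?t) * (dist V W * exp (2 * ?t) / 2)"
      by (intro mult_left_mono diffy) auto
    also have "\<dots> = (1/2) * dist V W" by (simp add: exp_minus)
    finally show "dist (\<Phi> V t) (\<Phi> W t) \<le> (1/2) * dist V W" .
  qed
  obtain W where W: "\<Phi> W = W"
    using banach_fix_type[of "1/2" \<Phi>] contr by auto
  let ?w = "apply_bcontfun W"
  have key: "max 0 (exp (2 * t) * ?w t) = y ?w t" if "0 \<le> t" for t
  proof -
    have "?w t = exp (- 2 * t) * y ?w t" using \<Phi>[of W t] that by (simp add: W F_def)
    then have "exp (2 * t) * ?w t = y ?w t" by (simp add: exp_minus)
    then show ?thesis using y0[OF cW, of W t] by simp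
  qed
  show ?thesis
  proof (intro exI conjI ballI)
    show "x ?w 0 = 1" "y ?w 0 = 0" by (simp_all add: x_def y_def P_def)
  next
    fix s assume s: "s \<in> {0..S}"
    show "(x ?w has_real_derivative - a * x ?w s - x ?w s * y ?w s) (at s within {0..S})"
      using dx[OF cW s, of W] s by (simp only: key atLeastAtMost_iff) (simp add: algebra_simps)
    show "(y ?w has_real_derivative - b * y ?w s + (x ?w s)\<^sup>2) (at s within {0..S})"
      by (rule dy[OF cW s])
    show "0 \<le> y ?w s" by (rule y0[OF cW])
  qed
qed

lemma interaction_hits:
  fixes a b q S :: real
  assumes a: "0 \<le> a" "a \<le> b" and q: "0 < q" "q < 1"
    and S: "S = 2 / (1 - q\<^sup>2)" and b: "b * (2 * S + 1) \<le> (1 - q\<^sup>2) / 2"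
  shows "\<exists>x y h. 0 < h \<and> h \<le> S \<and> x 0 = 1 \<and> y 0 = 0 \<and> y h = q \<and>
    (\<forall>s\<in>{0..h}. (x has_real_derivative - a * x s - x s * y s) (at s within {0..h}) \<and>
                (y has_real_derivative - b * y s + (x s)\<^sup>2) (at s within {0..h}))"
proof -
  from q have q2: "q\<^sup>2 < 1" by (simp add: power_less_one_iff abs_square_less_1)
  then have S0: "0 < S" by (simp add: S)
  obtain x y where i: "x 0 = 1" "y 0 = 0"
    and dx: "\<And>s. s\<in>{0..S} \<Longrightarrow> (x has_real_derivative - a * x s - x s * y s) (at s within {0..S})"
    and dy: "\<And>s. s\<in>{0..S} \<Longrightarrow> (y has_real_derivative - b * y s + (x s)\<^sup>2) (at s within {0..S})"
    and y0: "\<And>s. s\<in>{0..S} \<Longrightarrow> 0 \<le> y s"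
    using interaction_exists[of a b S] a by auto
  have cy: "continuous_on {0..S} y" using dy by (rule DERIV_continuous_on)
  have dxh: "(x has_real_derivative - a * x s - x s * y s) (at s within T)"
    and dyh: "(y has_real_derivative - b * y s + (x s)\<^sup>2) (at s within T)"
    if "s \<in> T" "T \<subseteq> {0..S}" for s T
    using that by (blast intro: has_field_derivative_subset dx dy)+
  have at: "at s within {0..S} = at s" if "0 < s" "s < S" for s
    using that by (intro at_within_interior) (auto simp: interior_atLeastAtMost_real)
  have energy: "(x s)\<^sup>2 + (y s)\<^sup>2 \<ge> 1 - 2 * b * S" if s: "s \<in> {0..S}" for s
  proof -
    let ?E = "\<lambda>r. ((x r)\<^sup>2 + (y r)\<^sup>2) * exp (2 * b * r)"
    have dE: "(?E has_real_derivative 2 * (b - a) * (x r)\<^sup>2 * exp (2 * b * r)) (at r within {0..S})"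
      if "r \<in> {0..S}" for r
      by (rule derivative_eq_intros dx[OF that] dy[OF that] refl)+
        (simp add: algebra_simps power2_eq_square)
    have "continuous_on {0..S} ?E" using dE by (rule DERIV_continuous_on)
    then have "continuous_on {0..s} ?E" by (rule continuous_on_subset) (use s in auto)
    then have "?E 0 \<le> ?E s"
    proof (rule DERIV_nonneg_imp_increasing_open[rotated 2])
      fix r assume "0 < r" "r < s"
      then show "\<exists>D. (?E has_real_derivative D) (at r) \<and> 0 \<le> D"
        using dE[of r] at[of r] s a by (intro exI[of _ "2 * (b - a) * (x r)\<^sup>2 * exp (2 * b * r)"]) auto
    qed (use s in auto)
    then have "exp (- (2 * b * s)) \<le> exp (- (2 * b * s)) * ?E s" by (simp add: i)
    also have "\<dots> = (x s)\<^sup>2 + (y s)\<^sup>2" by (simp add: exp_minus field_simps)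
    finally have "exp (- (2 * b * s)) \<le> (x s)\<^sup>2 + (y s)\<^sup>2" .
    moreover have "2 * b * s \<le> 2 * b * S" using s a by (intro mult_left_mono) auto
    ultimately show ?thesis using exp_ge_add_one_self[of "- (2 * b * s)"] by linarith
  qed
  have "\<exists>h\<in>{0..S}. q \<le> y h"
  proof (rule ccontr)
    assume "\<not> ?thesis"
    then have lt: "y s < q" if "s \<in> {0..S}" for s using that by force
    define c where "c = (1 - q\<^sup>2) / 2"
    have "y 0 - c * 0 \<le> y S - c * S"
    proof (rule DERIV_nonneg_imp_increasing_open[where f = "\<lambda>r. y r - c * r"])
      fix r assume r: "0 < r" "r < S"
      then have yr: "0 \<le> y r" "y r < q" using y0[of r] lt[of r] by auto
      then have "(y r)\<^sup>2 \<le> q\<^sup>2" by (intro power_mono) auto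
      moreover have "b * y r \<le> b * 1" using yr q a by (intro mult_left_mono) auto
      ultimately have "0 \<le> - b * y r + (x r)\<^sup>2 - c"
        using energy[of r] r b by (simp add: c_def field_simps)
      moreover have "((\<lambda>r. y r - c * r) has_real_derivative - b * y r + (x r)\<^sup>2 - c) (at r)"
        using dy[of r] r by (auto simp: at intro!: derivative_eq_intros)
      ultimately show "\<exists>D. ((\<lambda>r. y r - c * r) has_real_derivative D) (at r) \<and> 0 \<le> D" by blast
    qed (use S0 cy in \<open>auto intro!: continuous_intros\<close>)
    moreover have "c * S = 1" using q2 by (simp add: c_def S)
    ultimately show False using i lt[of S] S0 q by simp
  qed
  then obtain h' where h': "h' \<in> {0..S}" "q \<le> y h'" by blast
  then obtain h where h: "0 \<le> h" "h \<le> h'" "y h = q"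
    using IVT'[of y 0 q h'] i q h' continuous_on_subset[OF cy, of "{0..h'}"] by force
  have "0 < h" using h(1,3) i q by (metis order_le_less order_less_irrefl)
  moreover have "h \<le> S" "{0..h} \<subseteq> {0..S}" using h h' by auto
  ultimately show ?thesis using i h(3) dxh dyh
    by (intro exI[of _ x] exI[of _ y] exI[of _ h] conjI ballI) assumption+
qed

lemma interaction_hits_scaled:
  fixes A B C c q S :: real
  assumes pos: "0 \<le> A" "A \<le> C" "0 < B" "0 < c" and q: "0 < q" "q < 1"
    and S: "S = 2 / (1 - q\<^sup>2)" and C: "C / (c * B) * (2 * S + 1) \<le> (1 - q\<^sup>2) / 2"
  shows "\<exists>u v h. 0 < h \<and> h \<le> S / (c * B) \<and> u 0 = c \<and> v 0 = 0 \<and> v h = c * q \<and>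
    (\<forall>s\<in>{0..h}. (u has_real_derivative - A * u s - B * u s * v s) (at s within {0..h}) \<and>
                (v has_real_derivative - C * v s + B * (u s)\<^sup>2) (at s within {0..h}))"
proof -
  have cB: "0 < c * B" using pos by simp
  then obtain x y h where h: "0 < h" "h \<le> S" and i: "x 0 = 1" "y 0 = 0" "y h = q"
    and dx: "\<And>s. s \<in> {0..h} \<Longrightarrow>
      (x has_real_derivative - (A / (c * B)) * x s - x s * y s) (at s within {0..h})"
    and dy: "\<And>s. s \<in> {0..h} \<Longrightarrow>
      (y has_real_derivative - (C / (c * B)) * y s + (x s)\<^sup>2) (at s within {0..h})"
    using interaction_hits[of "A / (c * B)" "C / (c * B)", OF _ _ q S C] pos
    by (auto simp: divide_right_mono)
  define u where "u s = c * x (c * B * (s - 0))" for s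
  define v where "v s = c * y (c * B * (s - 0))" for s
  let ?I = "{0..h / (c * B)}"
  have im: "(\<lambda>r. c * B * (r - 0)) ` ?I \<subseteq> {0..h}"
    using cB by (auto simp: pos_le_divide_eq mult.commute mult.left_commute)
  show ?thesis
  proof (intro exI conjI ballI)
    show "0 < h / (c * B)" "h / (c * B) \<le> S / (c * B)" "u 0 = c" "v 0 = 0" "v (h / (c * B)) = c * q"
      using h i cB by (auto simp: u_def v_def divide_right_mono)
    fix s assume s: "s \<in> ?I"
    then have r: "c * B * (s - 0) \<in> {0..h}" using im by blast
    have [simp]: "c \<noteq> 0" "B \<noteq> 0" using pos by auto
    show "(u has_real_derivative - A * u s - B * u s * v s) (at s within ?I)"
      unfolding u_def v_def
      by (rule DERIV_cong[OF DERIV_cmult[OF has_real_derivative_affine[OF dx[OF r] im]]])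
        (simp add: field_simps)
    show "(v has_real_derivative - C * v s + B * (u s)\<^sup>2) (at s within ?I)"
      unfolding u_def v_def
      by (rule DERIV_cong[OF DERIV_cmult[OF has_real_derivative_affine[OF dy[OF r] im]]])
        (simp add: field_simps power2_eq_square)
  qed
qed

subsection \<open>Gluing the pieces of the cascade\<close>

locale cascade =
  fixes u v :: "nat \<Rightarrow> real \<Rightarrow> real" and h A B c :: "nat \<Rightarrow> real"
  assumes h_pos: "0 < h k"
    and h_summable: "summable h"
    and u_0: "u k 0 = c k" and v_0: "v k 0 = 0" and v_h: "v k (h k) = c (Suc k)"
    and u_deriv: "s \<in> {0..h k} \<Longrightarrow>
      (u k has_real_derivative - A k * u k s - B k * u k s * v k s) (at s within {0..h k})"
    and v_deriv: "s \<in> {0..h k} \<Longrightarrow>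
      (v k has_real_derivative - A (Suc k) * v k s + B k * (u k s)\<^sup>2) (at s within {0..h k})"
begin

definition t :: "nat \<Rightarrow> real" where "t k = sum h {..<k}"

definition T :: real where "T = suminf h"

definition Y :: "nat \<Rightarrow> real \<Rightarrow> real" where
  "Y k s = (if s < t k then (case k of 0 \<Rightarrow> 0 | Suc j \<Rightarrow> v j (max 0 (s - t j)))
            else if s \<le> t (Suc k) then u k (s - t k)
            else u k (h k) * exp (- A k * (s - t (Suc k))))"

lemma t_0: "t 0 = 0"
  by (simp add: t_def)

lemma t_Suc: "t (Suc k) = t k + h k"
  by (simp add: t_def)

lemma t_less_Suc: "t k < t (Suc k)"
  using h_pos by (simp add: t_Suc)

lemma t_strict_mono: "strict_mono t"
  by (simp add: strict_mono_Suc_iff t_less_Suc)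

lemma t_mono: "i \<le> j \<Longrightarrow> t i \<le> t j"
  using t_strict_mono by (simp add: strict_mono_less_eq)

lemma t_tendsto: "t \<longlonglongrightarrow> T"
  unfolding t_def T_def using h_summable by (rule summable_LIMSEQ)

lemma t_less_T: "t k < T"
  using incseq_le[OF _ t_tendsto, of "Suc k"] t_strict_mono t_less_Suc[of k]
  by (simp add: strict_mono_mono)

lemma piece_exists:
  assumes "0 \<le> s" "s < T"
  obtains k where "t k \<le> s" "s < t (Suc k)"
proof -
  have "\<exists>n. s < t n"
    using order_tendstoD(1)[OF t_tendsto assms(2)] by (auto simp: eventually_sequentially)
  then obtain n where n: "s < t n" "\<And>m. m < n \<Longrightarrow> \<not> s < t m"
    using exists_least_iff[of "\<lambda>n. s < t n"] by blast
  with assms t_0 obtain k where "n = Suc k" by (cases n) auto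
  with n that[of k] show ?thesis by force
qed

lemma Y_before: "s \<le> t k \<Longrightarrow> Y (Suc k) s = 0"
  using t_less_Suc[of k] by (simp add: Y_def v_0)

lemma Y_rising: "s \<in> {t k..t (Suc k)} \<Longrightarrow> Y (Suc k) s = v k (s - t k)"
  using t_less_Suc[of "Suc k"] by (auto simp: Y_def u_0 v_h t_Suc)

lemma Y_falling: "s \<in> {t k..t (Suc k)} \<Longrightarrow> Y k s = u k (s - t k)"
  by (simp add: Y_def)

lemma Y_after: "t (Suc k) \<le> s \<Longrightarrow> Y k s = u k (h k) * exp (- A k * (s - t (Suc k)))"
  using t_less_Suc[of k] by (auto simp: Y_def t_Suc)

lemma Y_at_t: "Y k (t k) = c k"
  using Y_falling[of "t k" k] t_less_Suc[of k] by (simp add: u_0)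

lemma Y_before_deriv:
  assumes "s \<le> t k"
  shows "(Y (Suc k) has_real_derivative 0) (at s within {..t k})"
  by (rule has_real_derivative_transform_on[of "\<lambda>_. 0"]) (use assms in \<open>auto simp: Y_before\<close>)

lemma interaction_piece:
  assumes "s \<in> {t k..t (Suc k)}"
  shows "(Y k has_real_derivative - A k * Y k s - B k * Y k s * Y (Suc k) s)
      (at s within {t k..t (Suc k)})" (is ?u)
    and "(Y (Suc k) has_real_derivative - A (Suc k) * Y (Suc k) s + B k * (Y k s)\<^sup>2)
      (at s within {t k..t (Suc k)})" (is ?v)
proof -
  have s: "1 * (s - t k) \<in> {0..h k}" using assms by (simp add: t_Suc)
  have im: "(\<lambda>r. 1 * (r - t k)) ` {t k..t (Suc k)} \<subseteq> {0..h k}" by (auto simp: t_Suc)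
  show ?u
    by (rule has_real_derivative_transform_on[OF
          DERIV_cong[OF has_real_derivative_affine[OF u_deriv[OF s] im]]])
      (use assms in \<open>auto simp: Y_rising Y_falling\<close>)
  show ?v
    by (rule has_real_derivative_transform_on[OF
          DERIV_cong[OF has_real_derivative_affine[OF v_deriv[OF s] im]]])
      (use assms in \<open>auto simp: Y_rising Y_falling\<close>)
qed

lemma Y_after_deriv:
  assumes "t (Suc k) \<le> s"
  shows "(Y k has_real_derivative - (A k * Y k s)) (at s within {t (Suc k)..})"
  by (rule has_real_derivative_transform_on[of
        "\<lambda>s. u k (h k) * exp (- A k * (s - t (Suc k)))"])
    (use assms in \<open>auto simp: Y_after intro!: derivative_eq_intros\<close>)

lemma Y_deriv_piece:
  assumes s: "s \<in> {t i..t (Suc i)}"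
  shows "(Y k has_real_derivative
      - A k * Y k s + (if k = Suc i then B i * (Y i s)\<^sup>2 else 0)
      - (if k = i then B k * Y k s * Y (Suc k) s else 0)) (at s within {t i..t (Suc i)})"
proof -
  consider "k = i" | "k = Suc i" | "k > Suc i" | "k < i" by linarith
  then show ?thesis
  proof cases
    case 1
    then show ?thesis using interaction_piece(1)[OF s] by simp
  next
    case 2
    then show ?thesis using interaction_piece(2)[OF s] by simp
  next
    case 3
    then obtain j where j: "k = Suc j" "Suc i \<le> j" by (cases k) auto
    then have "t (Suc i) \<le> t j" by (intro t_mono)
    with s j show ?thesis
      using has_field_derivative_subset[OF Y_before_deriv[of s j], of "{t i..t (Suc i)}"]
      by (auto simp: Y_before)
  next
    case 4
    then have "t (Suc k) \<le> t i" by (intro t_mono) auto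
    with s 4 show ?thesis
      using has_field_derivative_subset[OF Y_after_deriv[of k s], of "{t i..t (Suc i)}"]
      by auto
  qed
qed

lemma Y_deriv:
  assumes "s \<in> {t i<..<t (Suc i)}"
  shows "(Y k has_real_derivative
      - A k * Y k s + (if k = Suc i then B i * (Y i s)\<^sup>2 else 0)
      - (if k = i then B k * Y k s * Y (Suc k) s else 0)) (at s)"
proof -
  have "at s within {t i..t (Suc i)} = at s"
    using assms by (intro at_within_interior) (auto simp: interior_atLeastAtMost_real)
  then show ?thesis using Y_deriv_piece[of s i k] assms by simp
qed

lemma Y_continuous: "continuous_on {0..<T} (Y k)"
proof -
  have pc: "continuous_on {t i..t (Suc i)} (Y k)" for i
    using Y_deriv_piece by (rule DERIV_continuous_on)
  have cN: "continuous_on {0..t n} (Y k)" for n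
  proof (induction n)
    case 0
    then show ?case by (simp add: t_0)
  next
    case (Suc n)
    have "{0..t (Suc n)} = {0..t n} \<union> {t n..t (Suc n)}"
      using t_mono[of 0 n] t_less_Suc[of n] by (auto simp: t_0)
    then show ?case using Suc pc by (auto intro: continuous_on_closed_Un)
  qed
  have "continuous (at s within {0..<T}) (Y k)" if s: "s \<in> {0..<T}" for s
  proof -
    obtain n where n: "s < t (Suc n)" using piece_exists s by auto
    have "at s within {0..<T} = at s within {0..t (Suc n)}"
      by (rule at_within_nhd[of _ "{..<t (Suc n)}"]) (use n t_less_T[of "Suc n"] in auto)
    moreover have "continuous (at s within {0..t (Suc n)}) (Y k)"
      using cN[of "Suc n"] s n by (auto simp: continuous_on_eq_continuous_within)
    ultimately show ?thesis by simp
  qed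
  then show ?thesis by (simp add: continuous_on_eq_continuous_within)
qed

lemma smooth_before: "smooth_within {a..b} (Y (Suc k))" if "b \<le> t k"
  by (rule smooth_within_interaction(1)[of _ _ 0 0 "\<lambda>_. 0" 0 0])
    (use that in \<open>auto intro!: has_field_derivative_subset[OF Y_before_deriv]\<close>)

lemma smooth_interaction:
  assumes "t k \<le> a" "b \<le> t (Suc k)"
  shows "smooth_within {a..b} (Y k)" and "smooth_within {a..b} (Y (Suc k))"
proof -
  have sub: "{a..b} \<subseteq> {t k..t (Suc k)}" using assms by auto
  note d = interaction_piece[THEN has_field_derivative_subset, OF subsetD[OF sub] sub]
  show "smooth_within {a..b} (Y k)" "smooth_within {a..b} (Y (Suc k))"
    using smooth_within_interaction[OF d] by blast+
qed

lemma smooth_after: "smooth_within {a..b} (Y k)" if "t (Suc k) \<le> a"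
  by (rule smooth_within_interaction(1)[of _ _ "A k" 0 "\<lambda>_. 0" 0 0])
    (use that in \<open>auto intro!: has_field_derivative_subset[OF Y_after_deriv]\<close>)

lemma Y_piecewise_smooth: "piecewise_smooth_on {0..<T} (Y k)"
  unfolding piecewise_smooth_on_def
proof (intro exI[of _ "{t (k - 1), t k, t (Suc k)}"] conjI allI impI)
  fix a b
  assume ab: "a < b \<and> {a..b} \<subseteq> {0..<T} \<and> {a<..<b} \<inter> {t (k - 1), t k, t (Suc k)} = {}"
  then have "a \<in> {0..<T}" by (meson atLeastAtMost_iff less_imp_le order_refl subsetD)
  then have a: "0 \<le> a" by simp
  have br: "r \<le> a \<or> b \<le> r" if "r \<in> {t (k - 1), t k, t (Suc k)}" for r
    using ab that by force
  consider "t (Suc k) \<le> a" | "t k \<le> a" "b \<le> t (Suc k)" | "b \<le> t k" "t (k - 1) \<le> a"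
    | "b \<le> t (k - 1)"
    using br by blast
  then show "smooth_within {a..b} (Y k)"
  proof cases
    case 1
    then show ?thesis by (rule smooth_after)
  next
    case 2
    then show ?thesis by (rule smooth_interaction)
  next
    case 3
    show ?thesis
    proof (cases k)
      case 0
      with 3 a ab show ?thesis by (auto simp: t_0)
    next
      case (Suc j)
      with 3 show ?thesis using smooth_interaction(2)[of j a b] by simp
    qed
  next
    case 4
    show ?thesis
    proof (cases k)
      case 0
      with 4 a ab show ?thesis by (auto simp: t_0)
    next
      case (Suc j)
      with 4 show ?thesis using smooth_before[of b j a] by simp
    qed
  qed
qed simp


lemma piece_unique:
  assumes "s \<in> {t i<..<t (Suc i)}"
  shows "s \<in> {t j<..<t (Suc j)} \<longleftrightarrow> j = i"
proof
  assume s: "s \<in> {t j<..<t (Suc j)}"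
  have "t j < t (Suc i)" "t i < t (Suc j)" using assms s by auto
  then show "j = i" using t_strict_mono by (simp add: strict_mono_less)
qed (use assms in simp)

lemma frequently_at_left_T:
  assumes "\<exists>\<^sub>F k in sequentially. Q (t k)"
  shows "\<exists>\<^sub>F s in at_left T. Q s"
proof -
  have "filterlim t (at_left T) sequentially"
    unfolding filterlim_at using t_tendsto t_less_T by (auto simp: less_imp_neq)
  then show ?thesis
    using assms unfolding frequently_def filterlim_iff by blast
qed

end

theorem proposition5p1:
  fixes lam \<alpha> \<delta> :: real
  assumes "lam > 1" and "0 < \<alpha>" and "\<alpha> < 1/2" and "0 < \<delta>" and "\<delta> < 1 - 2 * \<alpha>"
  shows "\<exists>(n0::nat) (t :: nat \<Rightarrow> real) (T :: real) (X :: nat \<Rightarrow> real \<Rightarrow> real).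
      t n0 = 0 \<and>
      (\<forall>n\<ge>n0. t n < t (Suc n)) \<and>
      t \<longlonglongrightarrow> T \<and>
      (\<forall>n\<ge>n0. continuous_on {0..<T} (X n) \<and> piecewise_smooth_on {0..<T} (X n)) \<and>
      (\<forall>k\<ge>1. \<forall>s. 0 \<le> s \<and> s \<le> t (n0 + k - 1) \<longrightarrow> X (n0 + k) s = 0) \<and>
      (\<forall>n\<ge>n0. \<forall>s \<in> {0..<T} - t ` {n0..}.
         (X n has_real_derivative
            (- (lam powr (2 * real n * \<alpha>)) * X n s
             + indicator {prev_term n0 t n<..<t n} s
                 * lam powr (real n - 1) * (prev_term n0 (\<lambda>m. X m s) n)\<^sup>2
             - indicator {t n<..<t (Suc n)} s
                 * lam powr (real n) * X n s * X (Suc n) s)) (at s)) \<and>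
      (\<forall>k. X (n0 + k) (t (n0 + k)) = lam powr (- \<delta> * real k)) \<and>
      (\<forall>\<delta>'>\<delta>. Limsup (at_left T)
         (\<lambda>s. SUP n\<in>{n0..}. ereal (lam powr (\<delta>' * real n) * \<bar>X n s\<bar>)) = \<infinity>)"
proof -
  define q where "q = lam powr - \<delta>"
  have q: "0 < q" "q < 1" using assms by (auto simp: q_def powr_less_one)
  have q2: "q\<^sup>2 < 1" using q by (simp add: power_less_one_iff abs_square_less_1)
  define S where "S = 2 / (1 - q\<^sup>2)"
  have S: "0 < S" using q2 by (simp add: S_def)
  define K where "K = 2 * (2 * S + 1) / (1 - q\<^sup>2)"
  have K: "0 < K" using S q2 by (simp add: K_def)
  obtain n0 :: nat where n0: "(2 * \<alpha> + log lam K) / (1 - 2 * \<alpha>) < real n0"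
    using reals_Archimedean2 by blast
  define A where "A k = lam powr (2 * real (n0 + k) * \<alpha>)" for k
  define B where "B k = lam powr real (n0 + k)" for k
  define c where "c k = lam powr (- \<delta> * real k)" for k
  have c_Suc: "c (Suc k) = c k * q" for k
    using assms by (simp add: c_def q_def algebra_simps flip: powr_add)
  have small: "A (Suc k) / (c k * B k) * (2 * S + 1) \<le> (1 - q\<^sup>2) / 2" for k
  proof -
    have "0 \<le> real k * (1 - 2 * \<alpha> - \<delta>)" using assms by simp
    moreover have "2 * \<alpha> + log lam K \<le> real n0 * (1 - 2 * \<alpha>)"
      using n0 assms by (simp add: pos_divide_less_eq)
    ultimately have e: "2 * real (n0 + Suc k) * \<alpha> - (- \<delta> * real k + real (n0 + k)) \<le> - log lam K"
      by (simp add: algebra_simps)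
    have "A (Suc k) / (c k * B k) = lam powr (2 * real (n0 + Suc k) * \<alpha> - (- \<delta> * real k + real (n0 + k)))"
      unfolding A_def B_def c_def by (simp only: powr_diff powr_add)
    also have "\<dots> \<le> lam powr (- log lam K)" using e assms(1) by (intro powr_mono) auto
    also have "\<dots> = 1 / K" using assms(1) K by (simp add: powr_minus field_simps)
    finally have "A (Suc k) / (c k * B k) * (2 * S + 1) \<le> 1 / K * (2 * S + 1)"
      using S by (intro mult_right_mono) auto
    also have "\<dots> = (1 - q\<^sup>2) / 2" using S q2 by (simp add: K_def field_simps)
    finally show ?thesis .
  qed
  have "\<exists>u v h. 0 < h \<and> h \<le> S / (c k * B k) \<and> u 0 = c k \<and> v 0 = 0 \<and> v h = c (Suc k) \<and>
    (\<forall>s\<in>{0..h}. (u has_real_derivative - A k * u s - B k * u s * v s) (at s within {0..h}) \<and>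
      (v has_real_derivative - A (Suc k) * v s + B k * (u s)\<^sup>2) (at s within {0..h}))" for k
    unfolding c_Suc
  proof (rule interaction_hits_scaled[OF _ _ _ _ q S_def small])
    show "A k \<le> A (Suc k)" using assms by (auto simp: A_def intro!: powr_mono)
  qed (use assms in \<open>auto simp: A_def B_def c_def\<close>)
  then obtain u v h where h: "\<And>k. 0 < h k" "\<And>k. h k \<le> S / (c k * B k)"
    and uv: "\<And>k. u k 0 = c k" "\<And>k. v k 0 = 0" "\<And>k. v k (h k) = c (Suc k)"
    and du: "\<And>k s. s \<in> {0..h k} \<Longrightarrow>
      (u k has_real_derivative - A k * u k s - B k * u k s * v k s) (at s within {0..h k})"
    and dv: "\<And>k s. s \<in> {0..h k} \<Longrightarrow>
      (v k has_real_derivative - A (Suc k) * v k s + B k * (u k s)\<^sup>2) (at s within {0..h k})"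
    by metis
  have "summable h"
  proof (rule summable_comparison_test')
    show "summable (\<lambda>k. S * (lam powr (\<delta> - 1)) ^ k)"
      using assms by (intro summable_mult summable_geometric) (auto simp: powr_less_one)
    fix k
    have "S / (c k * B k) = S * lam powr (- (- \<delta> * real k + real (n0 + k)))"
      using S by (simp only: B_def c_def powr_minus powr_add divide_inverse)
    also have "\<dots> \<le> S * lam powr ((\<delta> - 1) * real k)"
      using S assms by (intro mult_left_mono powr_mono) (auto simp: algebra_simps)
    also have "\<dots> = S * (lam powr (\<delta> - 1)) ^ k"
      using assms by (simp add: powr_powr flip: powr_realpow)
    finally show "norm (h k) \<le> S * (lam powr (\<delta> - 1)) ^ k"
      using h(1)[of k] h(2)[of k] by simp
  qed
  then interpret cascade u v h A B c
    using h uv du dv by unfold_locales auto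
  define X where "X n = Y (n - n0)" for n
  define t' where "t' n = t (n - n0)" for n
  show ?thesis
  proof (intro exI conjI allI impI ballI)
    show "t' n0 = 0" by (simp add: t'_def t_0)
    show "t' n < t' (Suc n)" if "n \<ge> n0" for n
      using that t_less_Suc by (simp add: t'_def Suc_diff_le)
    show "t' \<longlonglongrightarrow> T"
      by (rule LIMSEQ_offset[of _ n0]) (simp add: t'_def t_tendsto)
    show "continuous_on {0..<T} (X n)" "piecewise_smooth_on {0..<T} (X n)" for n
      by (simp_all add: X_def Y_continuous Y_piecewise_smooth)
    show "X (n0 + k) s = 0" if "k \<ge> 1" "0 \<le> s \<and> s \<le> t' (n0 + k - 1)" for k s
      using that Y_before[of s "k - 1"] by (simp add: X_def t'_def)
    show val: "X (n0 + k) (t' (n0 + k)) = lam powr (- \<delta> * real k)" for k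
      by (simp add: X_def t'_def Y_at_t c_def)
  next
    fix n s assume n: "n0 \<le> n" and s: "s \<in> {0..<T} - t' ` {n0..}"
    obtain k where k: "n = n0 + k" using n le_Suc_ex by blast
    obtain i where i: "t i \<le> s" "s < t (Suc i)" using piece_exists s by auto
    have "t i \<in> t' ` {n0..}" by (rule image_eqI[of _ _ "n0 + i"]) (auto simp: t'_def)
    then have "t i \<noteq> s" using s by blast
    with i have i: "s \<in> {t i<..<t (Suc i)}" by simp
    have gain: "indicator {prev_term n0 t' n<..<t' n} s * lam powr (real n - 1) *
        (prev_term n0 (\<lambda>m. X m s) n)\<^sup>2 = (if k = Suc i then B i * (Y i s)\<^sup>2 else 0)"
    proof (cases k)
      case 0
      then show ?thesis by (simp add: k prev_term_def)
    next
      case (Suc j)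
      then show ?thesis
        using piece_unique[OF i, of j]
        by (auto simp: k prev_term_def t'_def X_def B_def indicator_def)
    qed
    have loss: "indicator {t' n<..<t' (Suc n)} s * lam powr (real n) * X n s * X (Suc n) s
      = (if k = i then B k * Y k s * Y (Suc k) s else 0)"
      using piece_unique[OF i, of k]
      by (auto simp: k t'_def X_def B_def indicator_def)
    show "(X n has_real_derivative
            (- (lam powr (2 * real n * \<alpha>)) * X n s
             + indicator {prev_term n0 t' n<..<t' n} s
                 * lam powr (real n - 1) * (prev_term n0 (\<lambda>m. X m s) n)\<^sup>2
             - indicator {t' n<..<t' (Suc n)} s
                 * lam powr (real n) * X n s * X (Suc n) s)) (at s)"
      unfolding gain loss using Y_deriv[OF i, of k] by (simp add: k X_def A_def)
  next
    fix \<delta>' assume \<delta>': "\<delta> < \<delta>'"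
    let ?f = "\<lambda>s. SUP n\<in>{n0..}. ereal (lam powr (\<delta>' * real n) * \<bar>X n s\<bar>)"
    have freq: "\<exists>\<^sub>F s in at_left T. y < ?f s" if y: "y < \<infinity>" for y
    proof (rule frequently_at_left_T)
      obtain r where r: "y \<le> ereal r" using y by (cases y) auto
      have "1 < lam powr (\<delta>' - \<delta>)" using assms \<delta>' by simp
      then obtain N where N: "r < (lam powr (\<delta>' - \<delta>)) ^ N" using real_arch_pow by blast
      have "y < ?f (t k)" if "k \<ge> N" for k
      proof -
        have "(lam powr (\<delta>' - \<delta>)) ^ N \<le> (lam powr (\<delta>' - \<delta>)) ^ k"
          using that \<open>1 < lam powr (\<delta>' - \<delta>)\<close> by (intro power_increasing) auto
        also have "\<dots> = lam powr ((\<delta>' - \<delta>) * real k)"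
          using assms by (simp add: powr_powr flip: powr_realpow)
        also have "\<dots> \<le> lam powr (\<delta>' * real (n0 + k) + - \<delta> * real k)"
          using assms \<delta>' by (intro powr_mono) (auto simp: algebra_simps)
        also have "\<dots> = lam powr (\<delta>' * real (n0 + k)) * \<bar>X (n0 + k) (t k)\<bar>"
          unfolding powr_add by (simp add: X_def Y_at_t c_def)
        finally have "r < lam powr (\<delta>' * real (n0 + k)) * \<bar>X (n0 + k) (t k)\<bar>"
          using N by linarith
        then have "y < ereal (lam powr (\<delta>' * real (n0 + k)) * \<bar>X (n0 + k) (t k)\<bar>)"
          using r by (simp add: order_le_less_trans)
        also have "\<dots> \<le> ?f (t k)" by (rule SUP_upper) simp
        finally show ?thesis .
      qed
      then show "\<exists>\<^sub>F k in sequentially. y < ?f (t k)"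
        by (intro eventually_frequently) (auto simp: eventually_sequentially)
    qed
    show "Limsup (at_left T) ?f = \<infinity>"
    proof (rule ccontr)
      assume "Limsup (at_left T) ?f \<noteq> \<infinity>"
      then obtain y where y: "Limsup (at_left T) ?f < y" "y < \<infinity>"
        using dense[of "Limsup (at_left T) ?f" \<infinity>] by auto
      have "\<forall>\<^sub>F s in at_left T. ?f s < y" using y(1) by (rule Limsup_lessD)
      then have "\<forall>\<^sub>F s in at_left T. \<not> y < ?f s" by (rule eventually_mono) auto
      with freq[OF y(2)] show False by (simp add: frequently_def)
    qed
  qed
qed

end
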